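(* If $\sigma_1,\sigma_2\in S(g)^{open}$, $\sigma_1\in\mathfrak D_{2g}$ and $\sigma_2\notin\mathfrak D_{2g}$, then $\sigma_1$ and $\sigma_2$ are not D-equivalent.
   Context: Let $p$ be an odd prime and $K=\mathbb Q(\sqrt{-\Delta})$ ($\Delta>0$ a squarefree integer) an imaginary quadratic field in which $p$ is inert. Put $\mathbb Z_{p^2}=\mathbb Z_p[\sqrt{-\Delta}]$, $\mathbb F_{p^2}=\mathbb F_p[\sqrt{-\Delta}]$; bar denotes the nontrivial automorphism over $\mathbb Z_p$, resp. $\mathbb F_p$, and tilde denotes reduction modulo $p$. Let $g=\mathfrak r+\mathfrak s$ and $E=E_{\mathfrak r\mathfrak s}=\mathrm{diag}(1,\dots,1,-1,\dots,-1)$ ($\mathfrak r$ ones, $\mathfrak s$ minus ones). Let $G_V(\mathbb Z_p)$ be the group of matrices $\mathfrak g=h+k\sqrt{-\Delta}$, $h,k\in M_g(\mathbb Z_p)$, with $\mathfrak gE\bar{\mathfrak g}^t=\lambda E$ for some $\lambda\in\mathbb Z_p^*$, and let $\alpha:G_V(\mathbb Z_p)\to GSp_{2g}(\mathbb Z_p)$, $\alpha(\mathfrak g)=\begin{pmatrix} h& kE\\ -\Delta Ek& EhE\end{pmatrix}$. $S(g)^{open}$ is the set of matrices $\sigma=\sigma(s)=\begin{pmatrix}1_g& s\\0&p1_g\end{pmatrix}$ where $s\in M_g(\mathbb Z)$ is symmetric with entries in a fixed system of residues modulo $p$. Let $\mathbb F_{p^2}$ act on row vectors $(x,y)\in\mathbb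 F_p^g\times\mathbb F_p^g$ by $\sqrt{-\Delta}\cdot(x,y)=(-\Delta yE,xE)$, and let $W_\sigma\subset\mathbb F_p^{2g}$ be the row space of $(1_g,\tilde s)$. For even $j$ with $g\le j\le 2g$, $\mathfrak D_j$ is the set of $\sigma$ with $\dim_{\mathbb F_p}(\mathbb F_{p^2}W_\sigma)=j$. Two elements $\sigma_1,\sigma_2$ are D-equivalent if there exists $\mathfrak g\in G_V(\mathbb Z_p)$ such that $\sigma_1\alpha(\mathfrak g)\sigma_2^{-1}\in GSp_{2g}(\mathbb Z_p)$. *)

theory Defs
  imports
    "HOL-Algebra.Ideal"
    "HOL-Library.Product_Plus"
    "HOL-Computational_Algebra.Normalized_Fraction"
    "HOL-Computational_Algebra.Squarefree"
    "HOL-Number_Theory.Cong"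
    "Berlekamp_Zassenhaus.Finite_Field"
    "Jordan_Normal_Form.VS_Connect"
    "Jordan_Normal_Form.Gauss_Jordan_Elimination"
begin

text \<open>
  As for \<^typ>\<open>'p mod_ring\<close>, the prime is carried by a type variable \<open>'p\<close> of class
  \<^class>\<open>prime_card\<close>; it is \<^term>\<open>CARD('p::prime_card)\<close>.
\<close>

text \<open>
  The inverse limit of the rings of integers modulo \<open>p ^ n\<close>: component \<open>n\<close> is the least
  nonnegative representative modulo \<open>p ^ n\<close>.
\<close>

typedef (overloaded) ('p::prime_card) padic_int =
  "{x :: nat \<Rightarrow> int. \<forall>n. x n \<in> {0..<int CARD('p) ^ n} \<and> x (Suc n) mod int CARD('p) ^ n = x n}"
proof -
  have "0 < int CARD('p)" using prime_card[where 'a='p] by (simp add: prime_gt_0_nat)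
  then show ?thesis by (intro exI[of _ "\<lambda>_. 0"]) simp
qed

setup_lifting type_definition_padic_int

lemma int_card_pos: "0 < int CARD('p::prime_card)"
  using prime_card[where 'a='p] by (simp add: prime_gt_0_nat)

lemma prime_int_card: "prime (int CARD('p::prime_card))"
  using prime_card[where 'a='p] by simp

lemma mod_power_Suc_mod: "a mod q ^ Suc n mod q ^ n = a mod q ^ n"
  and mod_power_mult_mod: "a mod (q ^ n * q) mod q ^ n = a mod q ^ n" for a q :: int
  by (simp_all add: mod_mod_cancel)

instantiation padic_int :: (prime_card) comm_ring_1
begin

lift_definition zero_padic_int :: "'a padic_int" is "\<lambda>_. 0"
  using int_card_pos[where 'p='a] by simp

lift_definition one_padic_int :: "'a padic_int" is "\<lambda>n. 1 mod int CARD('a) ^ n"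
  using int_card_pos[where 'p='a] by (auto simp: mod_power_Suc_mod mod_power_mult_mod simp del: power_Suc)

lift_definition plus_padic_int :: "'a padic_int \<Rightarrow> 'a padic_int \<Rightarrow> 'a padic_int"
  is "\<lambda>x y n. (x n + y n) mod int CARD('a) ^ n"
  using int_card_pos[where 'p='a]
  by (auto simp: mod_power_Suc_mod mod_power_mult_mod simp del: power_Suc) (metis mod_add_eq)

lift_definition minus_padic_int :: "'a padic_int \<Rightarrow> 'a padic_int \<Rightarrow> 'a padic_int"
  is "\<lambda>x y n. (x n - y n) mod int CARD('a) ^ n"
  using int_card_pos[where 'p='a]
  by (auto simp: mod_power_Suc_mod mod_power_mult_mod simp del: power_Suc) (metis mod_diff_eq)

lift_definition uminus_padic_int :: "'a padic_int \<Rightarrow> 'a padic_int"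
  is "\<lambda>x n. (- x n) mod int CARD('a) ^ n"
  using int_card_pos[where 'p='a]
  by (auto simp: mod_power_Suc_mod mod_power_mult_mod simp del: power_Suc) (metis mod_minus_eq)

lift_definition times_padic_int :: "'a padic_int \<Rightarrow> 'a padic_int \<Rightarrow> 'a padic_int"
  is "\<lambda>x y n. (x n * y n) mod int CARD('a) ^ n"
  using int_card_pos[where 'p='a]
  by (auto simp: mod_power_Suc_mod mod_power_mult_mod simp del: power_Suc) (metis mod_mult_eq)

instance
proof
  have one_neq: "(1::int) mod int CARD('a) ^ 1 \<noteq> 0"
    using prime_gt_1_int[OF prime_int_card[where 'p='a]] by simp
  show "(0::'a padic_int) \<noteq> 1"
    by transfer (metis one_neq)
  fix a b c :: "'a padic_int"
  show "a + b + c = a + (b + c)"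
    by transfer (simp add: fun_eq_iff mod_simps algebra_simps)
  show "a + b = b + a"
    by transfer (simp add: fun_eq_iff add.commute)
  show "0 + a = a"
    by transfer auto
  show "- a + a = 0"
    by transfer (simp add: fun_eq_iff mod_simps)
  show "a - b = a + - b"
    by transfer (simp add: fun_eq_iff mod_simps)
  show "a * b * c = a * (b * c)"
    by transfer (simp add: fun_eq_iff mod_simps mult.assoc)
  show "a * b = b * a"
    by transfer (simp add: fun_eq_iff mult.commute)
  show "1 * a = a"
    by transfer (auto simp: fun_eq_iff mod_simps)
  show "(a + b) * c = a * c + b * c"
    by transfer (simp add: fun_eq_iff mod_simps distrib_right)
qed

end

lemma Rep_padic_int_mod:
  assumes "n \<le> m"
  shows "Rep_padic_int (x :: 'p::prime_card padic_int) m mod int CARD('p) ^ n = Rep_padic_int x n"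
  using assms
proof (induction m rule: dec_induct)
  case base
  then show ?case using Rep_padic_int[of x] by auto
next
  case (step m)
  have "Rep_padic_int x (Suc m) mod int CARD('p) ^ n
      = Rep_padic_int x (Suc m) mod int CARD('p) ^ m mod int CARD('p) ^ n"
    using step.hyps by (subst mod_mod_cancel) (auto simp: le_imp_power_dvd)
  then show ?case using step.IH Rep_padic_int[of x] by auto
qed

lemma padic_int_eq_0_iff: "x = 0 \<longleftrightarrow> (\<forall>n. Rep_padic_int (x :: 'p::prime_card padic_int) n = 0)"
  by transfer auto

instance padic_int :: (prime_card) idom
proof
  fix x y :: "'a padic_int"
  let ?p = "int CARD('a)"
  assume "x \<noteq> 0" "y \<noteq> 0"
  then obtain n m where n: "Rep_padic_int x n \<noteq> 0" and m: "Rep_padic_int y m \<noteq> 0"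
    by (auto simp: padic_int_eq_0_iff)
  let ?X = "Rep_padic_int x (n + m)" and ?Y = "Rep_padic_int y (n + m)"
  have nX: "\<not> ?p ^ n dvd ?X" and mY: "\<not> ?p ^ m dvd ?Y"
    using n m Rep_padic_int_mod[of n "n + m" x] Rep_padic_int_mod[of m "n + m" y]
    by (auto simp: dvd_eq_mod_eq_0)
  have "\<not> ?p ^ (n + m) dvd ?X * ?Y"
  proof
    assume dvd: "?p ^ (n + m) dvd ?X * ?Y"
    have pe: "prime_elem ?p" by (rule prime_imp_prime_elem[OF prime_int_card])
    from prime_elem_power_dvd_cases[OF dvd, of n "Suc m"] pe
    have "?p ^ n dvd ?X \<or> ?p ^ Suc m dvd ?Y" by simp
    moreover have "?p ^ m dvd ?p ^ Suc m" by (rule le_imp_power_dvd) simp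
    ultimately show False using nX mY dvd_trans by blast
  qed
  then have "Rep_padic_int (x * y) (n + m) \<noteq> 0"
    by (simp add: times_padic_int.rep_eq dvd_eq_mod_eq_0)
  then show "x * y \<noteq> 0" by (metis padic_int_eq_0_iff)
qed

lemma Rep_padic_int_of_nat:
  "Rep_padic_int (of_nat k :: 'p::prime_card padic_int) n = int k mod int CARD('p) ^ n"
proof (induction k)
  case 0
  show ?case by (simp add: zero_padic_int.rep_eq)
next
  case (Suc k)
  then show ?case
    by (simp add: plus_padic_int.rep_eq one_padic_int.rep_eq mod_simps add.commute)
qed

lemma of_nat_card_padic_int_neq_0: "(of_nat CARD('p) :: 'p::prime_card padic_int) \<noteq> 0"
proof
  assume "(of_nat CARD('p) :: 'p padic_int) = 0"
  then have "int CARD('p) mod int CARD('p) ^ 2 = 0"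
    by (metis Rep_padic_int_of_nat padic_int_eq_0_iff)
  moreover have "int CARD('p) < int CARD('p) ^ 2"
    using prime_gt_1_int[OF prime_int_card[where 'p='p]] by (simp add: power2_eq_square)
  ultimately show False using int_card_pos[where 'p='p] by simp
qed

type_synonym 'p padic = "'p padic_int fract"

text \<open>
  The pair \<open>(a, b)\<close> stands for \<open>a + b * sqrt (- \<Delta>)\<close>, so \<^typ>\<open>'a \<times> 'a\<close> with componentwise
  addition and the following multiplication is \<open>'a[X] / (X\<^sup>2 + \<Delta>)\<close>.  It is used
  with \<^typ>\<open>'p padic_int\<close> and with \<^typ>\<open>'p mod_ring\<close>.
\<close>

definition quad_mult :: "nat \<Rightarrow> 'a::comm_ring_1 \<times> 'a \<Rightarrow> 'a \<times> 'a \<Rightarrow> 'a \<times> 'a" where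
  "quad_mult \<Delta> z w = (fst z * fst w - of_nat \<Delta> * snd z * snd w, fst z * snd w + snd z * fst w)"

definition quad_cnj :: "'a::comm_ring_1 \<times> 'a \<Rightarrow> 'a \<times> 'a" where
  "quad_cnj z = (fst z, - snd z)"

definition quad_of :: "'a::comm_ring_1 \<Rightarrow> 'a \<times> 'a" where
  "quad_of a = (a, 0)"

definition quad_ring :: "nat \<Rightarrow> ('a::comm_ring_1 \<times> 'a) ring" where
  "quad_ring \<Delta> = \<lparr>carrier = UNIV, monoid.mult = quad_mult \<Delta>, one = (1, 0), zero = 0, add = (+)\<rparr>"

lemma cring_quad_ring: "cring (quad_ring \<Delta> :: ('a::comm_ring_1 \<times> 'a) ring)"
proof (rule cringI)
  show "abelian_group (quad_ring \<Delta> :: ('a \<times> 'a) ring)"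
  proof (rule abelian_groupI)
    fix x :: "'a \<times> 'a"
    show "\<exists>y \<in> carrier (quad_ring \<Delta>). y \<oplus>\<^bsub>quad_ring \<Delta>\<^esub> x = \<zero>\<^bsub>quad_ring \<Delta>\<^esub>"
      by (intro bexI[of _ "- x"]) (simp_all add: quad_ring_def)
  qed (auto simp: quad_ring_def algebra_simps)
  show "comm_monoid (quad_ring \<Delta> :: ('a \<times> 'a) ring)"
    by (rule comm_monoidI) (auto simp: quad_ring_def quad_mult_def algebra_simps)
qed (auto simp: quad_ring_def quad_mult_def algebra_simps)

lemma quad_mult_sqrt: "quad_mult \<Delta> (0, 1) (0, 1) = quad_of (- of_nat \<Delta>)"
  by (simp add: quad_mult_def quad_of_def)

definition quad_mat_mult :: "nat \<Rightarrow> ('a::comm_ring_1 \<times> 'a) mat \<Rightarrow> ('a \<times> 'a) mat \<Rightarrow> ('a \<times> 'a) mat"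
  where "quad_mat_mult \<Delta> A B =
    mat (dim_row A) (dim_col B) (\<lambda>(i, j). \<Sum>k<dim_col A. quad_mult \<Delta> (A $$ (i, k)) (B $$ (k, j)))"

definition imag_quad_field :: "nat \<Rightarrow> complex set" where
  "imag_quad_field \<Delta> = {of_rat a + of_rat b * csqrt (- of_nat \<Delta>) | a b. True}"

definition imag_quad_integers :: "nat \<Rightarrow> complex ring" where
  "imag_quad_integers \<Delta> =
    \<lparr>carrier = {z \<in> imag_quad_field \<Delta>. algebraic_int z},
     monoid.mult = (*), one = 1, zero = 0, add = (+)\<rparr>"

definition inert_in_imag_quad_field :: "nat \<Rightarrow> nat \<Rightarrow> bool" where
  "inert_in_imag_quad_field p \<Delta> \<longleftrightarrow>
    primeideal (PIdl\<^bsub>imag_quad_integers \<Delta>\<^esub> (of_nat p)) (imag_quad_integers \<Delta>)"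

definition E_mat :: "nat \<Rightarrow> nat \<Rightarrow> 'a::comm_ring_1 mat" where
  "E_mat r s = mat (r + s) (r + s) (\<lambda>(i, j). if i = j then (if i < r then 1 else - 1) else 0)"

definition G_V :: "nat \<Rightarrow> nat \<Rightarrow> nat \<Rightarrow> ('p::prime_card padic_int \<times> 'p padic_int) mat set" where
  "G_V \<Delta> r s = {G \<in> carrier_mat (r + s) (r + s).
     \<exists>c :: 'p padic_int. c dvd 1 \<and>
       quad_mat_mult \<Delta> (quad_mat_mult \<Delta> G (map_mat quad_of (E_mat r s)))
         (transpose_mat (map_mat quad_cnj G))
       = map_mat quad_of (c \<cdot>\<^sub>m E_mat r s)}"

definition J_mat :: "nat \<Rightarrow> 'a::comm_ring_1 mat" where
  "J_mat g = four_block_mat (0\<^sub>m g g) (1\<^sub>m g) (- 1\<^sub>m g) (0\<^sub>m g g)"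

text \<open>Over the p-adic integers the multiplier is required to be a unit, so this is the integral
  group of symplectic similitudes for the standard form.\<close>

definition GSp :: "nat \<Rightarrow> 'a::comm_ring_1 mat set" where
  "GSp g = {M \<in> carrier_mat (2 * g) (2 * g).
     \<exists>c. c dvd 1 \<and> M * J_mat g * transpose_mat M = c \<cdot>\<^sub>m J_mat g}"

definition alpha :: "nat \<Rightarrow> nat \<Rightarrow> nat \<Rightarrow> ('a::comm_ring_1 \<times> 'a) mat \<Rightarrow> 'a mat" where
  "alpha \<Delta> r s G = (let h = map_mat fst G; k = map_mat snd G; E = E_mat r s in
     four_block_mat h (k * E) ((- of_nat \<Delta>) \<cdot>\<^sub>m (E * k)) (E * h * E))"

definition complete_residue_system :: "nat \<Rightarrow> int set \<Rightarrow> bool" where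
  "complete_residue_system p R \<longleftrightarrow> (\<forall>a. \<exists>!x. x \<in> R \<and> [x = a] (mod int p))"

definition sym_residue_mats :: "int set \<Rightarrow> nat \<Rightarrow> int mat set" where
  "sym_residue_mats R g =
    {S \<in> carrier_mat g g. transpose_mat S = S \<and> (\<forall>i<g. \<forall>j<g. S $$ (i, j) \<in> R)}"

definition sigma_mat :: "nat \<Rightarrow> int mat \<Rightarrow> int mat" where
  "sigma_mat p S = (let g = dim_row S in
     four_block_mat (1\<^sub>m g) S (0\<^sub>m g g) (int p \<cdot>\<^sub>m 1\<^sub>m g))"

definition S_open :: "nat \<Rightarrow> int set \<Rightarrow> nat \<Rightarrow> int mat set" where
  "S_open p R g = sigma_mat p ` sym_residue_mats R g"

text \<open>Row vectors are represented by \<^typ>\<open>'a vec\<close>, so right multiplication of a row vector by \<open>E\<close>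
  is multiplication by the transpose of \<open>E\<close>.\<close>

definition sqrt_act :: "nat \<Rightarrow> nat \<Rightarrow> nat \<Rightarrow> 'a::comm_ring_1 vec \<Rightarrow> 'a vec" where
  "sqrt_act \<Delta> r s v = (let x = vec_first v (r + s); y = vec_last v (r + s) in
     ((- of_nat \<Delta>) \<cdot>\<^sub>v (transpose_mat (E_mat r s) *\<^sub>v y)) @\<^sub>v (transpose_mat (E_mat r s) *\<^sub>v x))"

definition quad_act :: "nat \<Rightarrow> nat \<Rightarrow> nat \<Rightarrow> 'a::comm_ring_1 \<times> 'a \<Rightarrow> 'a vec \<Rightarrow> 'a vec" where
  "quad_act \<Delta> r s z v = fst z \<cdot>\<^sub>v v + snd z \<cdot>\<^sub>v sqrt_act \<Delta> r s v"

definition W_space :: "int mat \<Rightarrow> 'p::prime_card mod_ring vec set" where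
  "W_space S = (let g = dim_row S in
     vec_space.row_space (2 * g) (four_block_mat (1\<^sub>m g) (map_mat of_int S) (0\<^sub>m 0 g) (0\<^sub>m 0 g)))"

text \<open>The set of all finite sums of elements \<open>z w\<close> with \<open>z\<close> in the quadratic extension of the
  prime field and \<open>w \<in> W\<close>.\<close>

definition quad_span :: "nat \<Rightarrow> nat \<Rightarrow> nat \<Rightarrow> 'p::prime_card mod_ring vec set \<Rightarrow> 'p mod_ring vec set"
  where "quad_span \<Delta> r s W =
    LinearCombinations.module.span class_ring (module_vec TYPE('p mod_ring) (2 * (r + s)))
      {quad_act \<Delta> r s z w | z w. w \<in> W}"

definition subspace_dim :: "nat \<Rightarrow> 'a::field vec set \<Rightarrow> nat" where
  "subspace_dim n U = vectorspace.dim class_ring (module_vec TYPE('a) n\<lparr>carrier := U\<rparr>)"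

definition D_set :: "'p::prime_card itself \<Rightarrow> nat \<Rightarrow> nat \<Rightarrow> nat \<Rightarrow> int set \<Rightarrow> nat \<Rightarrow> int mat set" where
  "D_set _ \<Delta> r s R j = {sigma_mat CARD('p) S | S. S \<in> sym_residue_mats R (r + s) \<and>
     subspace_dim (2 * (r + s)) (quad_span \<Delta> r s (W_space S :: 'p mod_ring vec set)) = j}"

lemma of_nat_card_padic_neq_0: "(of_nat CARD('p) :: 'p::prime_card padic) \<noteq> 0"
proof -
  have "(of_nat k :: 'p padic) = to_fract (of_nat k)" for k
    by (induction k) simp_all
  then show ?thesis using of_nat_card_padic_int_neq_0[where 'p='p] by simp
qed

lemma mat_inverse_sigma_mat:
  fixes S :: "int mat"
  assumes S: "S \<in> carrier_mat g g"
  defines "\<sigma> \<equiv> map_mat of_int (sigma_mat CARD('p) S) :: 'p::prime_card padic mat"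
  shows "\<sigma> * the (mat_inverse \<sigma>) = 1\<^sub>m (2 * g)" "the (mat_inverse \<sigma>) * \<sigma> = 1\<^sub>m (2 * g)"
proof -
  let ?p = "of_nat CARD('p) :: 'p padic"
  let ?T = "map_mat of_int S :: 'p padic mat"
  have T: "?T \<in> carrier_mat g g" using S by simp
  have p: "?p \<noteq> 0" by (rule of_nat_card_padic_neq_0)
  have \<sigma>: "\<sigma> = four_block_mat (1\<^sub>m g) ?T (0\<^sub>m g g) (?p \<cdot>\<^sub>m 1\<^sub>m g)"
    using S unfolding \<sigma>_def sigma_mat_def by (intro eq_matI) auto
  have \<sigma>_carrier: "\<sigma> \<in> carrier_mat (2 * g) (2 * g)"
    unfolding \<sigma> using T by auto
  let ?B = "four_block_mat (1\<^sub>m g) (- inverse ?p \<cdot>\<^sub>m ?T) (0\<^sub>m g g) (inverse ?p \<cdot>\<^sub>m 1\<^sub>m g)"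
  have one: "four_block_mat (1\<^sub>m g) (0\<^sub>m g g) (0\<^sub>m g g) (1\<^sub>m g) = (1\<^sub>m (2 * g) :: 'p padic mat)"
    by (intro eq_matI) auto
  have B_carrier: "?B \<in> carrier_mat (2 * g) (2 * g)" using T by auto
  have "\<sigma> * ?B = four_block_mat (1\<^sub>m g * 1\<^sub>m g + ?T * 0\<^sub>m g g)
      (1\<^sub>m g * (- inverse ?p \<cdot>\<^sub>m ?T) + ?T * (inverse ?p \<cdot>\<^sub>m 1\<^sub>m g))
      (0\<^sub>m g g * 1\<^sub>m g + ?p \<cdot>\<^sub>m 1\<^sub>m g * 0\<^sub>m g g)
      (0\<^sub>m g g * (- inverse ?p \<cdot>\<^sub>m ?T) + ?p \<cdot>\<^sub>m 1\<^sub>m g * (inverse ?p \<cdot>\<^sub>m 1\<^sub>m g))"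
    unfolding \<sigma> by (rule mult_four_block_mat) (use T in auto)
  also have "1\<^sub>m g * 1\<^sub>m g + ?T * 0\<^sub>m g g = 1\<^sub>m g"
    using T by simp
  also have "1\<^sub>m g * (- inverse ?p \<cdot>\<^sub>m ?T) + ?T * (inverse ?p \<cdot>\<^sub>m 1\<^sub>m g) = 0\<^sub>m g g"
    using T by (subst mult_smult_distrib[OF T one_carrier_mat]) (intro eq_matI; auto)
  also have "0\<^sub>m g g * 1\<^sub>m g + ?p \<cdot>\<^sub>m 1\<^sub>m g * 0\<^sub>m g g = 0\<^sub>m g g"
    by simp
  also have "0\<^sub>m g g * (- inverse ?p \<cdot>\<^sub>m ?T) + ?p \<cdot>\<^sub>m 1\<^sub>m g * (inverse ?p \<cdot>\<^sub>m 1\<^sub>m g) = 1\<^sub>m g"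
    using T p
    by (subst mult_smult_distrib[of _ g g _ g], simp, simp,
        subst mult_smult_assoc_mat[of _ g g _ g], simp, simp) (intro eq_matI; auto)
  finally have "\<sigma> * ?B = four_block_mat (1\<^sub>m g) (0\<^sub>m g g) (0\<^sub>m g g) (1\<^sub>m g)" .
  then have r: "\<sigma> * ?B = 1\<^sub>m (2 * g)" using one by simp
  have l: "?B * \<sigma> = 1\<^sub>m (2 * g)"
    using mat_mult_left_right_inverse[OF \<sigma>_carrier B_carrier r] .
  have "\<sigma> \<in> Units (ring_mat TYPE('p padic) (2 * g) ())"
    unfolding Units_def ring_mat_def using \<sigma>_carrier B_carrier l r by auto
  then obtain C where C: "mat_inverse \<sigma> = Some C"
    using mat_inverse(1)[OF \<sigma>_carrier, where b="()"] by (cases "mat_inverse \<sigma>") auto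
  show "\<sigma> * the (mat_inverse \<sigma>) = 1\<^sub>m (2 * g)" "the (mat_inverse \<sigma>) * \<sigma> = 1\<^sub>m (2 * g)"
    using mat_inverse(2)[OF \<sigma>_carrier C] C by simp_all
qed

text \<open>The triple product lives in the matrices over the p-adic numbers; by the preceding lemma
  \<^const>\<open>the\<close> is only applied to an actual inverse when the second matrix is some
  \<^term>\<open>sigma_mat CARD('p::prime_card) S\<close>.\<close>

definition D_equivalent ::
  "'p::prime_card itself \<Rightarrow> nat \<Rightarrow> nat \<Rightarrow> nat \<Rightarrow> int mat \<Rightarrow> int mat \<Rightarrow> bool" where
  "D_equivalent _ \<Delta> r s \<sigma>\<^sub>1 \<sigma>\<^sub>2 \<longleftrightarrow>
    (\<exists>G \<in> G_V \<Delta> r s :: ('p padic_int \<times> 'p padic_int) mat set.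
      (map_mat of_int \<sigma>\<^sub>1 :: 'p padic mat) * map_mat to_fract (alpha \<Delta> r s G)
        * the (mat_inverse (map_mat of_int \<sigma>\<^sub>2))
      \<in> map_mat to_fract ` (GSp (r + s) :: 'p padic_int mat set))"

end

theory Submission
  imports Defs "Subresultants.More_Homomorphisms" "Jordan_Normal_Form.DL_Rank"
begin

text \<open>
  Write \<open>J\<close> for the matrix of multiplication by \<open>sqrt (- \<Delta>)\<close> on row vectors.  The space spanned
  over the quadratic extension by the row space \<open>W\<close> of \<open>(1, S)\<close> is \<open>W + W J\<close>, the row space of
  the square matrix whose upper half is \<open>(1, S)\<close> and whose lower half is \<open>(1, S) J\<close>; it is
  \<open>quad_span_mat\<close>.  So \<open>\<sigma>(S)\<close> lies in the top stratum exactly when this matrix has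
  nonzero determinant (\<open>subspace_dim_quad_span_iff\<close>).

  A D-equivalence of \<open>\<sigma>(S)\<close> and \<open>\<sigma>(T)\<close> is an equation \<open>\<sigma>(S) \<alpha>(G) = M \<sigma>(T)\<close> with \<open>M\<close> integral.
  Modulo \<open>p\<close> the lower half of each \<open>\<sigma>\<close> vanishes, and the upper half of the equation reads
  \<open>(1, S) \<alpha>(G) = A (1, T)\<close>, where \<open>A\<close> is the upper left block of \<open>M\<close>.  The matrices \<open>\<alpha>(G)\<close>
  commute with \<open>J\<close>, since they come from matrices over the quadratic ring.  Multiplying by \<open>J\<close>
  therefore gives \<open>(1, S) J \<alpha>(G) = A (1, T) J\<close> too, and the two halves combine
  (\<open>quad_span_mat_alpha\<close>) into a factorisation whose right factor is the square matrix of \<open>T\<close>.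
  Because \<open>\<alpha>\<close> is multiplicative, the unitary similitude relation for \<open>G\<close> makes
  \<open>det \<alpha>(G)\<close> a p-adic unit (\<open>det_alpha_unit\<close>).  Hence if the determinant for \<open>S\<close> is nonzero
  modulo \<open>p\<close>, so is the one for \<open>T\<close>: the top stratum is closed under D-equivalence.
\<close>

section \<open>Square and block matrices\<close>

lemma E_mat_carrier [simp]: "E_mat r s \<in> carrier_mat (r + s) (r + s)"
  by (simp add: E_mat_def)

lemma transpose_E_mat [simp]: "transpose_mat (E_mat r s) = E_mat r s"
  by (intro eq_matI) (auto simp: E_mat_def)

lemma E_mat_mult_self: "E_mat r s * E_mat r s = (1\<^sub>m (r + s) :: 'a::comm_ring_1 mat)"
proof (intro eq_matI)
  fix i j assume ij: "i < dim_row (1\<^sub>m (r + s) :: 'a mat)" "j < dim_col (1\<^sub>m (r + s) :: 'a mat)"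
  have "(E_mat r s * E_mat r s :: 'a mat) $$ (i, j)
      = (\<Sum>k\<in>{0..<r + s}. E_mat r s $$ (i, k) * E_mat r s $$ (k, j))"
    using ij by (simp add: E_mat_def scalar_prod_def)
  also have "\<dots> = E_mat r s $$ (i, i) * E_mat r s $$ (i, j)"
    using ij by (subst sum.remove[of _ i]) (auto simp: E_mat_def intro!: sum.neutral)
  finally show "(E_mat r s * E_mat r s :: 'a mat) $$ (i, j) = 1\<^sub>m (r + s) $$ (i, j)"
    using ij by (auto simp: E_mat_def)
qed (simp_all add: E_mat_def)

lemma E_mat_mult_self_left:
  assumes "X \<in> carrier_mat (r + s) (r + s)"
  shows "E_mat r s * (E_mat r s * X) = (X :: 'a::comm_ring_1 mat)"
  using assms
  by (subst assoc_mult_mat[of _ "r + s" "r + s" _ "r + s" _ "r + s", symmetric])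
    (simp_all add: E_mat_mult_self)

lemma smult_smult_mat: "a \<cdot>\<^sub>m (b \<cdot>\<^sub>m M) = (a * b :: 'a::comm_ring_1) \<cdot>\<^sub>m M"
  by (intro eq_matI) (simp_all add: mult.assoc)

text \<open>The general rules leave the inner dimensions as free unknowns, which the simplifier cannot
  guess for products; fixing one common size makes them usable as rewrite rules.\<close>

lemmas square_mat_simps =
  assoc_mult_mat[of _ n n _ n _ n] mult_add_distrib_mat[of _ n n _ n]
  add_mult_distrib_mat[of _ n n _ _ n] mult_smult_distrib[of _ n n _ n]
  mult_smult_assoc_mat[of _ n n _ n] mult_carrier_mat[of _ n n _ n] add_carrier_mat[of _ n n]
  add_smult_distrib_left_mat[of _ n n]
  left_mult_one_mat[of _ n n] right_mult_one_mat[of _ n n]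
  left_mult_zero_mat[of _ n n] right_mult_zero_mat[of _ n n] for n

lemma four_block_mat_upper_inject:
  assumes "four_block_mat A B C D = four_block_mat A' B' C' D'"
    and "A \<in> carrier_mat n m" "A' \<in> carrier_mat n m"
    and "B \<in> carrier_mat n l" "B' \<in> carrier_mat n l"
    and "D \<in> carrier_mat k l" "D' \<in> carrier_mat k l"
  shows "A = A'" "B = B'"
proof -
  have *: "four_block_mat A B C D $$ (i, j) = four_block_mat A' B' C' D' $$ (i, j)" for i j
    using assms(1) by simp
  show "A = A'"
  proof (intro eq_matI)
    fix i j assume "i < dim_row A'" "j < dim_col A'"
    then show "A $$ (i, j) = A' $$ (i, j)" using *[of i j] assms(2-) by simp
  qed (use assms in auto)
  show "B = B'"
  proof (intro eq_matI)
    fix i j assume "i < dim_row B'" "j < dim_col B'"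
    then show "B $$ (i, j) = B' $$ (i, j)" using *[of i "m + j"] assms(2-) by simp
  qed (use assms in auto)
qed

section \<open>The embedding alpha is multiplicative\<close>

lemma fst_quad_mat_mult:
  assumes "A \<in> carrier_mat n n" "B \<in> carrier_mat n n"
  shows "map_mat fst (quad_mat_mult \<Delta> A B)
    = map_mat fst A * map_mat fst B + (- of_nat \<Delta>) \<cdot>\<^sub>m (map_mat snd A * map_mat snd B)"
  using assms
  by (intro eq_matI) (auto simp: quad_mat_mult_def quad_mult_def scalar_prod_def fst_sum
      sum_subtractf sum_distrib_left mult.assoc atLeast0LessThan sum_negf)

lemma snd_quad_mat_mult:
  assumes "A \<in> carrier_mat n n" "B \<in> carrier_mat n n"
  shows "map_mat snd (quad_mat_mult \<Delta> A B)
    = map_mat fst A * map_mat snd B + map_mat snd A * map_mat fst B"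
  using assms
  by (intro eq_matI) (auto simp: quad_mat_mult_def quad_mult_def scalar_prod_def snd_sum
      sum.distrib atLeast0LessThan)

lemma quad_mat_mult_carrier:
  "A \<in> carrier_mat n m \<Longrightarrow> B \<in> carrier_mat m l \<Longrightarrow> quad_mat_mult \<Delta> A B \<in> carrier_mat n l"
  by (simp add: quad_mat_mult_def)

lemma alpha_carrier [simp]:
  "G \<in> carrier_mat (r + s) (r + s) \<Longrightarrow> alpha \<Delta> r s G \<in> carrier_mat (2 * (r + s)) (2 * (r + s))"
  unfolding alpha_def Let_def mult_2
  by (rule four_block_carrier_mat) (simp_all add: mult_carrier_mat[of _ "r + s" "r + s" _ "r + s"])

text \<open>
  After conjugation by the involution \<open>diag(1, E)\<close>, the matrix \<open>\<alpha>(h + k sqrt (- \<Delta>))\<close> becomes the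
  block matrix with rows \<open>(h, k)\<close> and \<open>(- \<Delta> k, h)\<close>, which is the regular representation of the
  quadratic ring over its base ring, applied to matrices.
\<close>

lemma alpha_mult:
  fixes A B :: "('a::comm_ring_1 \<times> 'a) mat"
  assumes "A \<in> carrier_mat (r + s) (r + s)" "B \<in> carrier_mat (r + s) (r + s)"
  shows "alpha \<Delta> r s (quad_mat_mult \<Delta> A B) = alpha \<Delta> r s A * alpha \<Delta> r s B"
proof -
  let ?n = "r + s" and ?d = "- of_nat \<Delta> :: 'a" and ?E = "E_mat r s :: 'a mat"
  define h k h' k' where hk: "h = map_mat fst A" "k = map_mat snd A"
    "h' = map_mat fst B" "k' = map_mat snd B"
  have c [simp]: "h \<in> carrier_mat ?n ?n" "k \<in> carrier_mat ?n ?n"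
    "h' \<in> carrier_mat ?n ?n" "k' \<in> carrier_mat ?n ?n" using assms by (auto simp: hk)
  have "alpha \<Delta> r s A * alpha \<Delta> r s B
    = four_block_mat h (k * ?E) (?d \<cdot>\<^sub>m (?E * k)) (?E * h * ?E)
    * four_block_mat h' (k' * ?E) (?d \<cdot>\<^sub>m (?E * k')) (?E * h' * ?E)"
    by (simp add: alpha_def hk Let_def)
  also have "\<dots> = four_block_mat (h * h' + k * ?E * (?d \<cdot>\<^sub>m (?E * k')))
      (h * (k' * ?E) + k * ?E * (?E * h' * ?E))
      (?d \<cdot>\<^sub>m (?E * k) * h' + ?E * h * ?E * (?d \<cdot>\<^sub>m (?E * k')))
      (?d \<cdot>\<^sub>m (?E * k) * (k' * ?E) + ?E * h * ?E * (?E * h' * ?E))"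
    by (rule mult_four_block_mat[of _ ?n ?n _ ?n _ ?n _ _ ?n _ ?n])
      (simp_all add: mult_carrier_mat[of _ ?n ?n _ ?n])
  also have "\<dots> = four_block_mat (h * h' + ?d \<cdot>\<^sub>m (k * k')) ((h * k' + k * h') * ?E)
      (?d \<cdot>\<^sub>m (?E * (h * k' + k * h'))) (?E * (h * h' + ?d \<cdot>\<^sub>m (k * k')) * ?E)"
    by (intro arg_cong4[where f = four_block_mat];
        simp add: square_mat_simps[where n = "r + s"] smult_smult_mat E_mat_mult_self_left
          comm_add_mat[of "h * k'" "r + s" "r + s" "k * h'"] del: assoc_mult_mat;
        intro comm_add_mat[of _ "r + s" "r + s"]; simp add: square_mat_simps[where n = "r + s"] del: assoc_mult_mat)
  also have "\<dots> = alpha \<Delta> r s (quad_mat_mult \<Delta> A B)"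
    using assms by (simp add: alpha_def Let_def hk fst_quad_mat_mult[of _ ?n] snd_quad_mat_mult[of _ ?n])
  finally show ?thesis ..
qed

lemma alpha_quad_of:
  assumes "M \<in> carrier_mat (r + s) (r + s)"
  shows "alpha \<Delta> r s (map_mat quad_of M)
    = four_block_mat M (0\<^sub>m (r + s) (r + s)) (0\<^sub>m (r + s) (r + s)) (E_mat r s * M * E_mat r s)"
proof -
  have "map_mat fst (map_mat quad_of M) = M" "map_mat snd (map_mat quad_of M) = 0\<^sub>m (r + s) (r + s)"
    using assms by (auto simp: quad_of_def)
  then show ?thesis by (simp add: alpha_def Let_def left_mult_zero_mat[of _ "r+s" "r+s"]
      right_mult_zero_mat[of _ "r+s" "r+s"])
qed

lemma det_mult_mult:
  assumes "A \<in> carrier_mat n n" "B \<in> carrier_mat n n" "C \<in> carrier_mat n n"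
  shows "det (A * B * C) = det A * det B * (det C :: 'a::comm_ring_1)"
  using assms by (simp add: det_mult[of _ n] mult_carrier_mat[of _ n n _ n] del: assoc_mult_mat)

text \<open>
  Applying \<open>\<alpha>\<close> to the similitude relation exhibits \<open>det \<alpha>(G)\<close> as a divisor of \<open>det \<alpha>(c E)\<close>.
  This in turn divides the determinant of \<open>\<alpha>(c E) \<alpha>(E) = c 1\<close>, a power of the unit \<open>c\<close>.
\<close>

lemma det_alpha_unit:
  assumes "G \<in> G_V \<Delta> r s"
  shows "det (alpha \<Delta> r s G) dvd 1"
proof -
  let ?n = "r + s" and ?E = "E_mat r s"
  obtain c where c: "c dvd 1" and G: "G \<in> carrier_mat ?n ?n"
    and eq: "quad_mat_mult \<Delta> (quad_mat_mult \<Delta> G (map_mat quad_of ?E))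
         (transpose_mat (map_mat quad_cnj G)) = map_mat quad_of (c \<cdot>\<^sub>m ?E)"
    using assms by (auto simp: G_V_def)
  have [simp]: "quad_mat_mult \<Delta> G (map_mat quad_of ?E) \<in> carrier_mat ?n ?n"
    using G by (auto intro!: quad_mat_mult_carrier)
  let ?G' = "transpose_mat (map_mat quad_cnj G)"
  have G': "?G' \<in> carrier_mat ?n ?n" using G by simp
  have "alpha \<Delta> r s (map_mat quad_of (c \<cdot>\<^sub>m ?E))
      = alpha \<Delta> r s G * alpha \<Delta> r s (map_mat quad_of ?E) * alpha \<Delta> r s ?G'"
    unfolding eq[symmetric] by (subst alpha_mult; (simp add: G G')?; subst alpha_mult; simp add: G)
  moreover have "det \<dots> = det (alpha \<Delta> r s G) * det (alpha \<Delta> r s (map_mat quad_of ?E))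
      * det (alpha \<Delta> r s ?G')"
    by (intro det_mult_mult[of _ "2 * ?n"] alpha_carrier) (simp_all add: G G')
  ultimately have "det (alpha \<Delta> r s G) dvd det (alpha \<Delta> r s (map_mat quad_of (c \<cdot>\<^sub>m ?E)))"
    by (simp only: mult.assoc dvd_triv_left)
  also have "\<dots> dvd det (alpha \<Delta> r s (map_mat quad_of (c \<cdot>\<^sub>m ?E)) * alpha \<Delta> r s (map_mat quad_of ?E))"
    by (subst det_mult[of _ "2 * ?n"]; (intro alpha_carrier dvd_triv_left; simp)?)
  also have "alpha \<Delta> r s (map_mat quad_of (c \<cdot>\<^sub>m ?E)) * alpha \<Delta> r s (map_mat quad_of ?E)
      = c \<cdot>\<^sub>m 1\<^sub>m (2 * ?n)"
  proof -
    have "alpha \<Delta> r s (map_mat quad_of (c \<cdot>\<^sub>m ?E)) * alpha \<Delta> r s (map_mat quad_of ?E)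
      = four_block_mat (c \<cdot>\<^sub>m 1\<^sub>m ?n) (0\<^sub>m ?n ?n) (0\<^sub>m ?n ?n) (c \<cdot>\<^sub>m 1\<^sub>m ?n)"
      by (simp add: alpha_quad_of square_mat_simps[where n = ?n] E_mat_mult_self
          mult_four_block_mat[of _ ?n ?n _ ?n _ ?n _ _ ?n _ ?n]
          smult_smult_mat E_mat_mult_self_left del: assoc_mult_mat)
    also have "\<dots> = c \<cdot>\<^sub>m 1\<^sub>m (2 * ?n)" by (intro eq_matI) auto
    finally show ?thesis .
  qed
  also have "det (c \<cdot>\<^sub>m 1\<^sub>m (2 * ?n)) = c ^ (2 * ?n)" by simp
  also have "\<dots> dvd 1" using dvd_power_same[OF c, of "2 * ?n"] by simp
  finally show ?thesis .
qed

lemma (in comm_ring_hom) hom_E_mat: "map_mat hom (E_mat r s) = E_mat r s"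
  by (intro eq_matI) (auto simp: E_mat_def hom_distribs)

lemma (in comm_ring_hom) hom_alpha:
  assumes "G \<in> carrier_mat (r + s) (r + s)"
  shows "map_mat hom (alpha \<Delta> r s G) = alpha \<Delta> r s (map_mat (map_prod hom hom) G)"
proof -
  let ?n = "r + s"
  have [simp]: "map_mat fst (map_mat (map_prod hom hom) G) = map_mat hom (map_mat fst G)"
    "map_mat snd (map_mat (map_prod hom hom) G) = map_mat hom (map_mat snd G)"
    by (auto intro!: eq_matI)
  have [simp]: "map_mat hom (x \<cdot>\<^sub>m M) = hom x \<cdot>\<^sub>m map_mat hom M" for x M
    by (intro eq_matI) (auto simp: hom_distribs)
  show ?thesis
    using assms unfolding alpha_def Let_def
    by (subst map_four_block_mat[of _ ?n ?n _ ?n _ ?n]) 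
      (auto simp: mat_hom_mult[of _ ?n ?n _ ?n] hom_E_mat hom_uminus hom_of_nat mult_carrier_mat[of _ ?n ?n _ ?n])
qed

section \<open>Generators of the span over the quadratic extension\<close>

text \<open>The lower half is the image of the rows of \<open>(1, S)\<close> under \<open>(x, y) \<mapsto> (- \<Delta> y E, x E)\<close>.\<close>

definition quad_span_mat :: "nat \<Rightarrow> nat \<Rightarrow> nat \<Rightarrow> 'a::comm_ring_1 mat \<Rightarrow> 'a mat" where
  "quad_span_mat \<Delta> r s S =
    four_block_mat (1\<^sub>m (r + s)) S ((- of_nat \<Delta>) \<cdot>\<^sub>m (S * E_mat r s)) (E_mat r s)"

lemma quad_span_mat_carrier [simp]:
  "S \<in> carrier_mat (r + s) (r + s) \<Longrightarrow> quad_span_mat \<Delta> r s S \<in> carrier_mat (2 * (r + s)) (2 * (r + s))"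
  unfolding quad_span_mat_def mult_2 by (intro four_block_carrier_mat) auto

text \<open>
  The hypotheses \<open>1\<close> and \<open>2\<close> are the two blocks of \<open>(1, S) \<alpha>(G) = A (1, T)\<close>.  The lower half of
  the conclusion is this equation multiplied by \<open>sqrt (- \<Delta>)\<close>, which commutes with \<open>\<alpha>(G)\<close>.
\<close>

lemma quad_span_mat_alpha:
  fixes S T P :: "'a::comm_ring_1 mat"
  assumes S: "S \<in> carrier_mat (r + s) (r + s)" and T: "T \<in> carrier_mat (r + s) (r + s)"
    and G: "G \<in> carrier_mat (r + s) (r + s)" and A: "A \<in> carrier_mat (r + s) (r + s)"
    and 1: "A = map_mat fst G + S * ((- of_nat \<Delta>) \<cdot>\<^sub>m (E_mat r s * map_mat snd G))"
    and 2: "A * T = map_mat snd G * E_mat r s + S * (E_mat r s * map_mat fst G * E_mat r s)"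
  shows "quad_span_mat \<Delta> r s S * alpha \<Delta> r s G
    = four_block_mat A (0\<^sub>m (r + s) (r + s)) (0\<^sub>m (r + s) (r + s)) A * quad_span_mat \<Delta> r s T"
proof -
  let ?n = "r + s" and ?d = "- of_nat \<Delta> :: 'a" and ?E = "E_mat r s :: 'a mat"
  define h k where hk: "h = map_mat fst G" "k = map_mat snd G"
  have c [simp]: "h \<in> carrier_mat ?n ?n" "k \<in> carrier_mat ?n ?n" using G by (auto simp: hk)
  note S[simp] T[simp]
  have "quad_span_mat \<Delta> r s S * alpha \<Delta> r s G
    = four_block_mat (1\<^sub>m ?n * h + S * (?d \<cdot>\<^sub>m (?E * k)))
      (1\<^sub>m ?n * (k * ?E) + S * (?E * h * ?E))
      (?d \<cdot>\<^sub>m (S * ?E) * h + ?E * (?d \<cdot>\<^sub>m (?E * k)))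
      (?d \<cdot>\<^sub>m (S * ?E) * (k * ?E) + ?E * (?E * h * ?E))"
    unfolding quad_span_mat_def alpha_def Let_def hk[symmetric]
    by (rule mult_four_block_mat[of _ ?n ?n _ ?n _ ?n _ _ ?n _ ?n])
      (simp_all add: mult_carrier_mat[of _ ?n ?n _ ?n])
  also have "1\<^sub>m ?n * h + S * (?d \<cdot>\<^sub>m (?E * k)) = A"
    by (simp add: 1 hk[symmetric] left_mult_one_mat[of _ ?n ?n])
  also have "1\<^sub>m ?n * (k * ?E) + S * (?E * h * ?E) = A * T"
    by (simp add: 2 hk[symmetric] left_mult_one_mat[of _ ?n ?n] mult_carrier_mat[of _ ?n ?n _ ?n])
  also have "?d \<cdot>\<^sub>m (S * ?E) * h + ?E * (?d \<cdot>\<^sub>m (?E * k)) = ?d \<cdot>\<^sub>m (A * T * ?E)"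
    unfolding 2 hk[symmetric]
    by (simp add: square_mat_simps[where n = "r + s"] smult_smult_mat E_mat_mult_self_left E_mat_mult_self del: assoc_mult_mat;
        intro comm_add_mat[of _ "r + s" "r + s"]; simp add: square_mat_simps[where n = "r + s"])
  also have "?d \<cdot>\<^sub>m (S * ?E) * (k * ?E) + ?E * (?E * h * ?E) = A * ?E"
    unfolding 1 hk[symmetric]
    by (simp add: square_mat_simps[where n = "r + s"] smult_smult_mat E_mat_mult_self_left del: assoc_mult_mat;
        intro comm_add_mat[of _ "r + s" "r + s"]; simp add: square_mat_simps[where n = "r + s"])
  also have "four_block_mat A (A * T) (?d \<cdot>\<^sub>m (A * T * ?E)) (A * ?E)
    = four_block_mat (A * 1\<^sub>m ?n + 0\<^sub>m ?n ?n * (?d \<cdot>\<^sub>m (T * ?E))) (A * T + 0\<^sub>m ?n ?n * ?E)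
      (0\<^sub>m ?n ?n * 1\<^sub>m ?n + A * (?d \<cdot>\<^sub>m (T * ?E))) (0\<^sub>m ?n ?n * T + A * ?E)"
    using A by (simp add: square_mat_simps[where n = "r + s"] left_mult_zero_mat[of _ ?n ?n] del: assoc_mult_mat)
  also have "\<dots> = four_block_mat A (0\<^sub>m ?n ?n) (0\<^sub>m ?n ?n) A * quad_span_mat \<Delta> r s T"
    unfolding quad_span_mat_def using A
    by (intro mult_four_block_mat[of _ ?n ?n _ ?n _ ?n _ _ ?n _ ?n, symmetric])
      (simp_all add: mult_carrier_mat[of _ ?n ?n _ ?n])
  finally show ?thesis .
qed

text \<open>
  The reduction modulo \<open>p\<close> of \<open>\<sigma>(S)\<close> has vanishing lower half, so a factorisation of
  \<open>\<sigma>(S) \<alpha>(G)\<close> through \<open>\<sigma>(T)\<close> involves only the left blocks of \<open>P\<close>, and its upper half only the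
  upper left block \<open>A\<close>; \<open>Q\<close> is \<open>diag(A, A)\<close>.
\<close>

lemma quad_span_mat_factor:
  fixes S T P :: "'a::comm_ring_1 mat"
  assumes S: "S \<in> carrier_mat (r + s) (r + s)" and T: "T \<in> carrier_mat (r + s) (r + s)"
    and G: "G \<in> carrier_mat (r + s) (r + s)" and P: "P \<in> carrier_mat (2 * (r + s)) (2 * (r + s))"
    and eq: "four_block_mat (1\<^sub>m (r + s)) S (0\<^sub>m (r + s) (r + s)) (0\<^sub>m (r + s) (r + s)) * alpha \<Delta> r s G
      = P * four_block_mat (1\<^sub>m (r + s)) T (0\<^sub>m (r + s) (r + s)) (0\<^sub>m (r + s) (r + s))"
  obtains Q where "Q \<in> carrier_mat (2 * (r + s)) (2 * (r + s))"
    "quad_span_mat \<Delta> r s S * alpha \<Delta> r s G = Q * quad_span_mat \<Delta> r s T"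
proof -
  let ?n = "r + s" and ?d = "- of_nat \<Delta> :: 'a" and ?E = "E_mat r s :: 'a mat"
  let ?O = "0\<^sub>m ?n ?n :: 'a mat"
  define h k where hk: "h = map_mat fst G" "k = map_mat snd G"
  have c: "h \<in> carrier_mat ?n ?n" "k \<in> carrier_mat ?n ?n" using G by (auto simp: hk)
  obtain A B C D where split: "split_block P ?n ?n = (A, B, C, D)"
    by (metis prod_cases4)
  have d: "dim_row P = ?n + ?n" "dim_col P = ?n + ?n" using P by auto
  note ABCD = split_block[OF split d]
  note cs = mult_carrier_mat[of _ "r + s" "r + s" _ "r + s"] add_carrier_mat[of _ "r + s" "r + s"]
  have "four_block_mat (1\<^sub>m ?n * h + S * (?d \<cdot>\<^sub>m (?E * k))) (1\<^sub>m ?n * (k * ?E) + S * (?E * h * ?E))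
      (?O * h + ?O * (?d \<cdot>\<^sub>m (?E * k))) (?O * (k * ?E) + ?O * (?E * h * ?E))
    = four_block_mat (1\<^sub>m ?n) S ?O ?O * alpha \<Delta> r s G"
    unfolding alpha_def Let_def hk[symmetric]
    by (rule mult_four_block_mat[of _ ?n ?n _ ?n _ ?n _ _ ?n _ ?n, symmetric])
      (simp_all add: cs c S)
  also have "\<dots> = four_block_mat A B C D * four_block_mat (1\<^sub>m ?n) T ?O ?O"
    unfolding eq by (simp only: ABCD(5)[symmetric])
  also have "\<dots> = four_block_mat (A * 1\<^sub>m ?n + B * ?O) (A * T + B * ?O)
      (C * 1\<^sub>m ?n + D * ?O) (C * T + D * ?O)"
    by (rule mult_four_block_mat[of _ ?n ?n _ ?n _ ?n _ _ ?n _ ?n]) (simp_all add: ABCD(1-4) T)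
  finally have e: "four_block_mat (1\<^sub>m ?n * h + S * (?d \<cdot>\<^sub>m (?E * k))) (1\<^sub>m ?n * (k * ?E) + S * (?E * h * ?E))
      (?O * h + ?O * (?d \<cdot>\<^sub>m (?E * k))) (?O * (k * ?E) + ?O * (?E * h * ?E))
    = four_block_mat (A * 1\<^sub>m ?n + B * ?O) (A * T + B * ?O)
      (C * 1\<^sub>m ?n + D * ?O) (C * T + D * ?O)" .
  have "1\<^sub>m ?n * h + S * (?d \<cdot>\<^sub>m (?E * k)) = A * 1\<^sub>m ?n + B * ?O"
    and "1\<^sub>m ?n * (k * ?E) + S * (?E * h * ?E) = A * T + B * ?O"
    by (rule four_block_mat_upper_inject[OF e, of ?n ?n ?n ?n]; simp add: cs c S T ABCD(1-4))+
  moreover have "A * 1\<^sub>m ?n + B * ?O = A" "1\<^sub>m ?n * h = h" "1\<^sub>m ?n * (k * ?E) = k * ?E"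
    "A * T + B * ?O = A * T"
    using ABCD(1,2) T c by (simp_all add: left_mult_one_mat[of _ ?n ?n] right_mult_zero_mat[of _ ?n ?n]
      right_mult_one_mat[of _ ?n ?n] right_add_zero_mat[of _ ?n ?n] cs)
  ultimately have 1: "A = h + S * (?d \<cdot>\<^sub>m (?E * k))" and 2: "A * T = k * ?E + S * (?E * h * ?E)"
    by (simp_all only:)
  show ?thesis
  proof
    show "four_block_mat A ?O ?O A \<in> carrier_mat (2 * ?n) (2 * ?n)"
      unfolding mult_2 by (rule four_block_carrier_mat[OF ABCD(1) ABCD(1)])
    show "quad_span_mat \<Delta> r s S * alpha \<Delta> r s G = four_block_mat A ?O ?O A * quad_span_mat \<Delta> r s T"
      by (rule quad_span_mat_alpha[OF S T G ABCD(1) 1[unfolded hk] 2[unfolded hk]])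
  qed
qed

section \<open>The top stratum in terms of a determinant\<close>

text \<open>The combination of the rows of \<open>quad_span_mat\<close> with coefficients \<open>u\<close> for the upper and \<open>v\<close>
  for the lower half, that is, \<open>u (1, S) + sqrt (- \<Delta>) v (1, S)\<close>.\<close>

definition quad_row :: "nat \<Rightarrow> nat \<Rightarrow> nat \<Rightarrow> 'a::comm_ring_1 mat \<Rightarrow> 'a vec \<Rightarrow> 'a vec \<Rightarrow> 'a vec" where
  "quad_row \<Delta> r s S u v =
    (u + (- of_nat \<Delta>) \<cdot>\<^sub>v (E_mat r s *\<^sub>v (transpose_mat S *\<^sub>v v)))
    @\<^sub>v (transpose_mat S *\<^sub>v u + E_mat r s *\<^sub>v v)"

lemma W_space_eq:
  assumes "S \<in> carrier_mat g g"
  shows "(W_space S :: 'p::prime_card mod_ring vec set)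
    = {y @\<^sub>v (transpose_mat (map_mat of_int S) *\<^sub>v y) | y. y \<in> carrier_vec g}"
proof -
  interpret vec_space "TYPE('p mod_ring)" "2 * g" .
  let ?S = "map_mat of_int S :: 'p mod_ring mat"
  let ?B = "four_block_mat (1\<^sub>m g) ?S (0\<^sub>m 0 g) (0\<^sub>m 0 g)"
  have B: "?B \<in> carrier_mat g (2 * g)"
    using four_block_carrier_mat[of "1\<^sub>m g" g g "0\<^sub>m 0 g" 0 g ?S "0\<^sub>m 0 g"] by (simp add: mult_2)
  have product: "transpose_mat ?B *\<^sub>v y = y @\<^sub>v (transpose_mat ?S *\<^sub>v y)" if y: "y \<in> carrier_vec g" for y
  proof -
    have "transpose_mat ?B = four_block_mat (1\<^sub>m g) (0\<^sub>m g 0) (transpose_mat ?S) (0\<^sub>m g 0)"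
      using assms by (subst transpose_four_block_mat[of _ g g _ g _ 0]) (auto intro!: eq_matI)
    \<comment> \<open>the zero-height lower blocks of \<open>?B\<close> need an empty second half of \<open>y\<close>\<close>
    moreover have "y = y @\<^sub>v 0\<^sub>v 0" by (intro eq_vecI) auto
    ultimately have "transpose_mat ?B *\<^sub>v y
        = four_block_mat (1\<^sub>m g) (0\<^sub>m g 0) (transpose_mat ?S) (0\<^sub>m g 0) *\<^sub>v (y @\<^sub>v 0\<^sub>v 0)" by simp
    also have "\<dots> = (1\<^sub>m g *\<^sub>v y + 0\<^sub>m g 0 *\<^sub>v 0\<^sub>v 0) @\<^sub>v (transpose_mat ?S *\<^sub>v y + 0\<^sub>m g 0 *\<^sub>v 0\<^sub>v 0)"
      by (rule four_block_mat_mult_vec[of _ g g _ 0 _ g]) (use assms y in auto)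
    also have "\<dots> = y @\<^sub>v (transpose_mat ?S *\<^sub>v y)"
      using y assms by (intro eq_vecI) (auto simp: scalar_prod_def)
    finally show ?thesis .
  qed
  have "W_space S = row_space ?B"
    using assms by (simp only: W_space_def Let_def carrier_matD)
  also have "\<dots> = {w \<in> carrier_vec (2 * g). \<exists>y \<in> carrier_vec g. transpose_mat ?B *\<^sub>v y = w}"
    using row_space_eq[OF B] by (simp only: carrier_matD[OF B])
  also have "\<dots> = {y @\<^sub>v (transpose_mat ?S *\<^sub>v y) | y. y \<in> carrier_vec g}"
  proof (intro equalityI subsetI)
    fix w assume "w \<in> {w \<in> carrier_vec (2 * g). \<exists>y \<in> carrier_vec g. transpose_mat ?B *\<^sub>v y = w}"
    then obtain y where y: "y \<in> carrier_vec g" and w: "w = transpose_mat ?B *\<^sub>v y" by blast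
    show "w \<in> {y @\<^sub>v (transpose_mat ?S *\<^sub>v y) | y. y \<in> carrier_vec g}"
      unfolding w product[OF y] by (intro CollectI exI[of _ y] conjI refl y)
  next
    fix w assume "w \<in> {y @\<^sub>v (transpose_mat ?S *\<^sub>v y) | y. y \<in> carrier_vec g}"
    then obtain y where y: "y \<in> carrier_vec g" and w: "w = y @\<^sub>v (transpose_mat ?S *\<^sub>v y)" by blast
    show "w \<in> {w \<in> carrier_vec (2 * g). \<exists>y \<in> carrier_vec g. transpose_mat ?B *\<^sub>v y = w}"
      unfolding w product[OF y, symmetric]
      by (intro CollectI conjI bexI[of _ y] refl y
          mult_mat_vec_carrier[OF transpose_carrier_mat[THEN iffD2, OF B]])
  qed
  finally show ?thesis .
qed

lemma row_space_quad_span_mat: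
  fixes S :: "'a::field mat"
  assumes S: "S \<in> carrier_mat (r + s) (r + s)"
  shows "vec_space.row_space (2 * (r + s)) (quad_span_mat \<Delta> r s S)
    = {quad_row \<Delta> r s S u v | u v. u \<in> carrier_vec (r + s) \<and> v \<in> carrier_vec (r + s)}"
proof -
  let ?n = "r + s" and ?E = "E_mat r s :: 'a mat" and ?N = "quad_span_mat \<Delta> r s S"
  interpret vec_space "TYPE('a)" "2 * (r + s)" .
  have N: "?N \<in> carrier_mat (2 * ?n) (2 * ?n)" by (rule quad_span_mat_carrier[OF S])
  have *: "transpose_mat ?N *\<^sub>v (u @\<^sub>v v) = quad_row \<Delta> r s S u v"
    if u: "u \<in> carrier_vec ?n" and v: "v \<in> carrier_vec ?n" for u v
  proof -
    have smult: "transpose_mat (c \<cdot>\<^sub>m X) = c \<cdot>\<^sub>m transpose_mat X" for c and X :: "'a mat"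
      by (intro eq_matI) auto
    have "transpose_mat ?N = four_block_mat (1\<^sub>m ?n) ((- of_nat \<Delta>) \<cdot>\<^sub>m (?E * transpose_mat S))
        (transpose_mat S) ?E"
      unfolding quad_span_mat_def
      by (subst transpose_four_block_mat[of _ ?n ?n _ ?n _ ?n])
        (use S in \<open>auto simp: smult transpose_mult[of _ ?n ?n _ ?n] mult_carrier_mat[of _ ?n ?n _ ?n]\<close>)
    then have "transpose_mat ?N *\<^sub>v (u @\<^sub>v v)
      = (1\<^sub>m ?n *\<^sub>v u + ((- of_nat \<Delta>) \<cdot>\<^sub>m (?E * transpose_mat S)) *\<^sub>v v)
        @\<^sub>v (transpose_mat S *\<^sub>v u + ?E *\<^sub>v v)"
      using S u v
      by (simp only:) (rule four_block_mat_mult_vec[of _ ?n ?n _ ?n _ ?n],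
        auto simp: mult_carrier_mat[of _ ?n ?n _ ?n])
    also have "((- of_nat \<Delta>) \<cdot>\<^sub>m (?E * transpose_mat S)) *\<^sub>v v
        = (- of_nat \<Delta>) \<cdot>\<^sub>v (?E *\<^sub>v (transpose_mat S *\<^sub>v v))"
      using S v by (subst assoc_mult_mat_vec[of _ ?n ?n _ ?n, symmetric]) (auto intro!: eq_vecI)
    finally show ?thesis using u by (simp add: quad_row_def)
  qed
  show ?thesis
  proof (intro equalityI subsetI)
    fix w assume "w \<in> row_space ?N"
    then obtain y where y: "y \<in> carrier_vec (2 * ?n)" "w = transpose_mat ?N *\<^sub>v y"
      using row_space_eq[OF N] N by auto
    then have "w = quad_row \<Delta> r s S (vec_first y ?n) (vec_last y ?n)"
      using vec_first_last_append[of y ?n ?n]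
      by (subst *[symmetric]) (simp_all only: mult_2 vec_first_carrier vec_last_carrier)
    then show "w \<in> {quad_row \<Delta> r s S u v | u v. u \<in> carrier_vec ?n \<and> v \<in> carrier_vec ?n}"
      by (blast intro: vec_first_carrier vec_last_carrier)
  next
    fix w assume "w \<in> {quad_row \<Delta> r s S u v | u v. u \<in> carrier_vec ?n \<and> v \<in> carrier_vec ?n}"
    then obtain u v where uv: "u \<in> carrier_vec ?n" "v \<in> carrier_vec ?n"
      and w: "w = transpose_mat ?N *\<^sub>v (u @\<^sub>v v)" by (auto simp: *)
    from uv have "u @\<^sub>v v \<in> carrier_vec (2 * ?n)" unfolding mult_2 by (rule append_carrier_vec)
    then show "w \<in> row_space ?N"
      using row_space_eq[OF N] N w by auto
  qed
qed

lemma quad_act_graph: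
  fixes S :: "'a::field mat"
  assumes S: "S \<in> carrier_mat (r + s) (r + s)" and y: "y \<in> carrier_vec (r + s)"
  shows "quad_act \<Delta> r s z (y @\<^sub>v (transpose_mat S *\<^sub>v y)) = quad_row \<Delta> r s S (fst z \<cdot>\<^sub>v y) (snd z \<cdot>\<^sub>v y)"
proof -
  let ?n = "r + s" and ?E = "E_mat r s :: 'a mat"
  define w where "w = transpose_mat S *\<^sub>v y"
  have w: "w \<in> carrier_vec ?n" using S y by (simp add: w_def)
  have [simp]: "vec_first (y @\<^sub>v w) ?n = y" "vec_last (y @\<^sub>v w) ?n = w"
    using y w by (auto simp: vec_first_def vec_last_def)
  have mv: "transpose_mat S *\<^sub>v (c \<cdot>\<^sub>v y) = c \<cdot>\<^sub>v w" "?E *\<^sub>v (c \<cdot>\<^sub>v y) = c \<cdot>\<^sub>v (?E *\<^sub>v y)"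
    "?E *\<^sub>v (c \<cdot>\<^sub>v w) = c \<cdot>\<^sub>v (?E *\<^sub>v w)" for c
    using S y w by (auto simp: w_def mult_mat_vec[of _ ?n ?n])
  have e: "?E *\<^sub>v y \<in> carrier_vec ?n" "?E *\<^sub>v w \<in> carrier_vec ?n"
    using y w by (simp_all add: mult_mat_vec_carrier[OF E_mat_carrier])
  define a b where ab: "a = ?E *\<^sub>v y" "b = ?E *\<^sub>v w"
  have "a \<in> carrier_vec ?n" "b \<in> carrier_vec ?n" using e by (simp_all add: ab)
  then show ?thesis
    using y w unfolding quad_act_def sqrt_act_def quad_row_def Let_def w_def[symmetric] mv
      transpose_E_mat \<open>vec_first (y @\<^sub>v w) ?n = y\<close> \<open>vec_last (y @\<^sub>v w) ?n = w\<close> ab[symmetric]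
    by (intro eq_vecI) (auto simp: mult_ac)
qed

lemma quad_row_split:
  fixes S :: "'a::comm_ring_1 mat"
  assumes S: "S \<in> carrier_mat (r + s) (r + s)"
    and u: "u \<in> carrier_vec (r + s)" and v: "v \<in> carrier_vec (r + s)"
  shows "quad_row \<Delta> r s S u v
    = quad_row \<Delta> r s S u (0\<^sub>v (r + s)) + quad_row \<Delta> r s S (0\<^sub>v (r + s)) v"
proof -
  let ?n = "r + s" and ?E = "E_mat r s :: 'a mat"
  define a b c where abc: "a = transpose_mat S *\<^sub>v u" "b = ?E *\<^sub>v v"
    "c = ?E *\<^sub>v (transpose_mat S *\<^sub>v v)"
  have carrier: "a \<in> carrier_vec ?n" "b \<in> carrier_vec ?n" "c \<in> carrier_vec ?n"
    using S u v unfolding abc by (auto intro!: mult_mat_vec_carrier[of _ ?n ?n])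
  have zero: "transpose_mat S *\<^sub>v 0\<^sub>v ?n = 0\<^sub>v ?n" "?E *\<^sub>v 0\<^sub>v ?n = 0\<^sub>v ?n"
    using S carrier_matD[OF E_mat_carrier[of r s, where ?'a = 'a]] by (auto intro!: eq_vecI)
  show ?thesis
    unfolding quad_row_def zero abc[symmetric] using carrier u v by (intro eq_vecI) auto
qed

text \<open>
  The products \<open>z w\<close> are the \<open>quad_row\<close> vectors with proportional coefficients \<open>u\<close> and \<open>v\<close>, so they
  lie in the row space.  Taking \<open>z = 1\<close> and \<open>z = sqrt (- \<Delta>)\<close> gives those with \<open>v = 0\<close> and
  \<open>u = 0\<close>, and every \<open>quad_row\<close> vector is a sum of one of each.
\<close>

lemma quad_span_W_space:
  assumes S: "S \<in> carrier_mat (r + s) (r + s)"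
  shows "quad_span \<Delta> r s (W_space S)
    = vec_space.row_space (2 * (r + s)) (quad_span_mat \<Delta> r s (map_mat of_int S) :: 'p::prime_card mod_ring mat)"
proof -
  let ?n = "r + s" and ?S = "map_mat of_int S :: 'p mod_ring mat"
  let ?N = "quad_span_mat \<Delta> r s ?S"
  define X where "X = {quad_act \<Delta> r s z w | z w. w \<in> (W_space S :: 'p mod_ring vec set)}"
  interpret vec_space "TYPE('p mod_ring)" "2 * (r + s)" .
  have S': "?S \<in> carrier_mat ?n ?n" using S by simp
  have N: "?N \<in> carrier_mat (2 * ?n) (2 * ?n)" by (rule quad_span_mat_carrier[OF S'])
  have X: "X = {quad_row \<Delta> r s ?S (fst z \<cdot>\<^sub>v y) (snd z \<cdot>\<^sub>v y) | z y. y \<in> carrier_vec ?n}"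
  proof (intro equalityI subsetI)
    fix x assume "x \<in> X"
    then obtain z y where y: "y \<in> carrier_vec ?n"
      and x: "x = quad_act \<Delta> r s z (y @\<^sub>v (transpose_mat ?S *\<^sub>v y))"
      unfolding X_def W_space_eq[OF S] by blast
    show "x \<in> {quad_row \<Delta> r s ?S (fst z \<cdot>\<^sub>v y) (snd z \<cdot>\<^sub>v y) | z y. y \<in> carrier_vec ?n}"
      unfolding x quad_act_graph[OF S' y] using y by blast
  next
    fix x assume "x \<in> {quad_row \<Delta> r s ?S (fst z \<cdot>\<^sub>v y) (snd z \<cdot>\<^sub>v y) | z y. y \<in> carrier_vec ?n}"
    then obtain z y where y: "y \<in> carrier_vec ?n"
      and x: "x = quad_row \<Delta> r s ?S (fst z \<cdot>\<^sub>v y) (snd z \<cdot>\<^sub>v y)"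
      by blast
    show "x \<in> X"
      unfolding x quad_act_graph[OF S' y, symmetric] X_def W_space_eq[OF S] using y by blast
  qed
  have R: "set (rows ?N) \<subseteq> carrier_vec (2 * ?n)" using N by (auto simp: rows_def)
  have XN: "X \<subseteq> row_space ?N"
    unfolding X row_space_quad_span_mat[OF S'] by (blast intro: smult_carrier_vec[THEN iffD2])
  have "row_space ?N \<subseteq> carrier_vec (2 * ?n)" using row_space_eq[OF N] N by auto
  with XN have Xc: "X \<subseteq> carrier_vec (2 * ?n)" by blast
  have "row_space ?N \<subseteq> span X"
  proof
    fix w assume "w \<in> row_space ?N"
    then obtain u v where uv: "u \<in> carrier_vec ?n" "v \<in> carrier_vec ?n" and w: "w = quad_row \<Delta> r s ?S u v"
      unfolding row_space_quad_span_mat[OF S'] by blast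
    let ?o = "0\<^sub>v ?n :: 'p mod_ring vec"
    have zero: "0 \<cdot>\<^sub>v u = ?o" "0 \<cdot>\<^sub>v v = ?o"
      using uv by (auto intro!: eq_vecI)
    have "quad_row \<Delta> r s ?S (1 \<cdot>\<^sub>v u) (0 \<cdot>\<^sub>v u) \<in> X"
      unfolding X using uv(1) by (intro CollectI exI[of _ "(1, 0)"] exI[of _ u]) simp
    from span_mem[OF Xc this] have 1: "quad_row \<Delta> r s ?S u ?o \<in> span X"
      by (simp only: zero one_smult_vec)
    have "quad_row \<Delta> r s ?S (0 \<cdot>\<^sub>v v) (1 \<cdot>\<^sub>v v) \<in> X"
      unfolding X using uv(2) by (intro CollectI exI[of _ "(0, 1)"] exI[of _ v]) simp
    from span_mem[OF Xc this] have 2: "quad_row \<Delta> r s ?S ?o v \<in> span X"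
      by (simp only: zero one_smult_vec)
    have "quad_row \<Delta> r s ?S u ?o + quad_row \<Delta> r s ?S ?o v \<in> span X"
      using span_add1[OF Xc 1 2] .
    moreover have "w = quad_row \<Delta> r s ?S u ?o + quad_row \<Delta> r s ?S ?o v"
      unfolding w by (rule quad_row_split[OF S' uv])
    ultimately show "w \<in> span X" by (simp only:)
  qed
  moreover have "span X \<subseteq> row_space ?N"
    using XN unfolding row_space_def by (rule span_subsetI[OF R])
  ultimately show ?thesis unfolding quad_span_def X_def[symmetric] by (metis subset_antisym)
qed

lemma subspace_dim_quad_span_iff:
  assumes S: "S \<in> carrier_mat (r + s) (r + s)"
  shows "subspace_dim (2 * (r + s)) (quad_span \<Delta> r s (W_space S :: 'p::prime_card mod_ring vec set)) = 2 * (r + s)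
    \<longleftrightarrow> det (quad_span_mat \<Delta> r s (map_mat of_int S) :: 'p mod_ring mat) \<noteq> 0"
proof -
  let ?N = "quad_span_mat \<Delta> r s (map_mat of_int S) :: 'p mod_ring mat"
  interpret vec_space "TYPE('p mod_ring)" "2 * (r + s)" .
  have N: "?N \<in> carrier_mat (2 * (r + s)) (2 * (r + s))" using S by (intro quad_span_mat_carrier) simp
  have "subspace_dim (2 * (r + s)) (quad_span \<Delta> r s (W_space S :: 'p mod_ring vec set)) = rank (transpose_mat ?N)"
    unfolding quad_span_W_space[OF S] subspace_dim_def rank_def row_space_def cols_transpose ..
  then show ?thesis
    using det_rank_iff[OF transpose_carrier_mat[THEN iffD2, OF N]]
    by (simp only: det_transpose[OF N])
qed

section \<open>D-equivalence modulo p\<close>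

definition padic_residue :: "'p::prime_card padic_int \<Rightarrow> 'p mod_ring" where
  "padic_residue x = of_int (Rep_padic_int x 1)"

lemma of_int_mod_card: "(of_int (a mod int CARD('p)) :: 'p::prime_card mod_ring) = of_int a"
  by (simp add: of_int_of_int_mod_ring; transfer; simp)

interpretation padic_residue: comm_ring_hom "padic_residue :: 'p::prime_card padic_int \<Rightarrow> _"
  by unfold_locales (simp_all add: padic_residue_def of_int_mod_card zero_padic_int.rep_eq
    one_padic_int.rep_eq plus_padic_int.rep_eq times_padic_int.rep_eq)


lemma sigma_mat_carrier:
  assumes "S \<in> carrier_mat g g"
  shows "sigma_mat p S \<in> carrier_mat (2 * g) (2 * g)"
  unfolding sigma_mat_def Let_def mult_2 using assms by (intro four_block_carrier_mat) auto

lemma sigma_mat_mod_p: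
  assumes "S \<in> carrier_mat g g"
  shows "map_mat of_int (sigma_mat CARD('p) S)
    = four_block_mat (1\<^sub>m g) (map_mat of_int S :: 'p::prime_card mod_ring mat) (0\<^sub>m g g) (0\<^sub>m g g)"
  \<comment> \<open>the instance says that \<open>p\<close> itself reduces to zero\<close>
  using assms of_int_mod_card[of "int CARD('p)"]
  by (intro eq_matI) (auto simp: sigma_mat_def Let_def)

text \<open>
  Multiplying by \<open>\<sigma>(T)\<close> on the right removes the inverse, and all remaining entries are p-adic
  integers, so the equation descends along the embedding into the fraction field.
\<close>

lemma D_equivalentE:
  fixes S T :: "int mat"
  assumes "D_equivalent TYPE('p::prime_card) \<Delta> r s (sigma_mat CARD('p) S) (sigma_mat CARD('p) T)"
    and S: "S \<in> carrier_mat (r + s) (r + s)" and T: "T \<in> carrier_mat (r + s) (r + s)"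
  obtains G :: "('p::prime_card padic_int \<times> 'p padic_int) mat" and M where "G \<in> G_V \<Delta> r s"
    "M \<in> carrier_mat (2 * (r + s)) (2 * (r + s))"
    "map_mat of_int (sigma_mat CARD('p) S) * alpha \<Delta> r s G = M * map_mat of_int (sigma_mat CARD('p) T)"
proof -
  define N where "N = 2 * (r + s)"
  let ?F = "map_mat to_fract :: 'p padic_int mat \<Rightarrow> 'p padic mat"
  define X Y where XY: "X = (map_mat of_int (sigma_mat CARD('p) S) :: 'p padic_int mat)"
    "Y = (map_mat of_int (sigma_mat CARD('p) T) :: 'p padic_int mat)"
  define I where "I = the (mat_inverse (?F Y))"
  have fract: "map_mat of_int Z = ?F (map_mat of_int Z)" for Z
    by (intro eq_matI) (simp_all add: to_fract_hom.hom_of_int)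
  obtain G :: "('p padic_int \<times> 'p padic_int) mat" and M :: "'p padic_int mat"
    where G: "G \<in> G_V \<Delta> r s" and M: "M \<in> GSp (r + s)" and eq: "?F X * ?F (alpha \<Delta> r s G) * I = ?F M"
    using assms(1) unfolding D_equivalent_def fract XY I_def by blast
  have Gc: "G \<in> carrier_mat (r + s) (r + s)" using G by (simp add: G_V_def)
  have c: "alpha \<Delta> r s G \<in> carrier_mat N N" "X \<in> carrier_mat N N" "Y \<in> carrier_mat N N" "M \<in> carrier_mat N N"
    unfolding N_def XY using alpha_carrier[OF Gc] sigma_mat_carrier[OF S] sigma_mat_carrier[OF T] M
    by (auto simp only: map_carrier_mat GSp_def)
  have inv: "?F Y * I = 1\<^sub>m N" "I * ?F Y = 1\<^sub>m N"
    using mat_inverse_sigma_mat[OF T, where 'p = 'p] unfolding I_def N_def XY fract by blast+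
  have Ic: "I \<in> carrier_mat N N"
    using arg_cong[OF inv(1), of dim_col] arg_cong[OF inv(2), of dim_row] by auto
  have Fc: "?F X \<in> carrier_mat N N" "?F (alpha \<Delta> r s G) \<in> carrier_mat N N" "?F Y \<in> carrier_mat N N"
    using c by simp_all
  have "?F (M * Y) = ?F X * ?F (alpha \<Delta> r s G) * I * ?F Y"
    using c by (simp add: eq to_fract_hom.mat_hom_mult[of _ N N _ N])
  also have "\<dots> = ?F X * ?F (alpha \<Delta> r s G)"
    unfolding assoc_mult_mat[OF mult_carrier_mat[OF Fc(1,2)] Ic Fc(3)] inv(2)
    by (rule right_mult_one_mat[OF mult_carrier_mat[OF Fc(1,2)]])
  also have "\<dots> = ?F (X * alpha \<Delta> r s G)"
    using c by (simp add: to_fract_hom.mat_hom_mult[of _ N N _ N])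
  finally have "X * alpha \<Delta> r s G = M * Y" by (metis to_fract_hom.mat_hom_inj)
  then show ?thesis using that G c(4) by (simp add: N_def XY)
qed

text \<open>
  Compare determinants in the reduced identity \<open>N(S) \<alpha>(G) = Q N(T)\<close> with \<open>N\<close> the matrix
  \<open>quad_span_mat\<close>: reduction modulo \<open>p\<close> keeps the unit \<open>det \<alpha>(G)\<close> nonzero.
\<close>

lemma D_equivalent_imp_det:
  fixes S T :: "int mat"
  assumes "D_equivalent TYPE('p::prime_card) \<Delta> r s (sigma_mat CARD('p) S) (sigma_mat CARD('p) T)"
    and S: "S \<in> carrier_mat (r + s) (r + s)" and T: "T \<in> carrier_mat (r + s) (r + s)"
    and det: "det (quad_span_mat \<Delta> r s (map_mat of_int S :: 'p mod_ring mat)) \<noteq> 0"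
  shows "det (quad_span_mat \<Delta> r s (map_mat of_int T :: 'p mod_ring mat)) \<noteq> 0"
proof -
  let ?n = "r + s"
  let ?\<pi> = "map_mat padic_residue :: 'p padic_int mat \<Rightarrow> 'p mod_ring mat"
  let ?S = "map_mat of_int S :: 'p mod_ring mat" and ?T = "map_mat of_int T :: 'p mod_ring mat"
  obtain G :: "('p padic_int \<times> 'p padic_int) mat" and M where G: "G \<in> G_V \<Delta> r s"
    and M: "M \<in> carrier_mat (2 * ?n) (2 * ?n)"
    and eq: "map_mat of_int (sigma_mat CARD('p) S) * alpha \<Delta> r s G = M * map_mat of_int (sigma_mat CARD('p) T)"
    using D_equivalentE[OF assms(1-3)] by blast
  define H where "H = map_mat (map_prod padic_residue padic_residue) G"
  have Gc: "G \<in> carrier_mat ?n ?n" using G by (simp add: G_V_def)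
  have Hc: "H \<in> carrier_mat ?n ?n" and c: "?S \<in> carrier_mat ?n ?n" "?T \<in> carrier_mat ?n ?n"
    "?\<pi> M \<in> carrier_mat (2 * ?n) (2 * ?n)"
    using Gc S T M by (simp_all only: H_def map_carrier_mat)
  have zc: "map_mat of_int (sigma_mat CARD('p) X) \<in> carrier_mat (2 * ?n) (2 * ?n)"
    if "X \<in> carrier_mat ?n ?n" for X
    using sigma_mat_carrier[OF that] by (simp only: map_carrier_mat)
  have zred: "?\<pi> (map_mat of_int X) = map_mat of_int X" for X
    by (intro eq_matI) (simp_all add: padic_residue.hom_of_int)
  have "map_mat of_int (sigma_mat CARD('p) S) * alpha \<Delta> r s H = ?\<pi> M * map_mat of_int (sigma_mat CARD('p) T)"
    using arg_cong[OF eq, of ?\<pi>]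
    unfolding padic_residue.mat_hom_mult[OF zc[OF S] alpha_carrier[OF Gc]]
      padic_residue.mat_hom_mult[OF M zc[OF T]] padic_residue.hom_alpha[OF Gc] zred H_def .
  then obtain Q where Q: "Q \<in> carrier_mat (2 * ?n) (2 * ?n)"
    and "quad_span_mat \<Delta> r s ?S * alpha \<Delta> r s H = Q * quad_span_mat \<Delta> r s ?T"
    unfolding sigma_mat_mod_p[OF S] sigma_mat_mod_p[OF T]
    using quad_span_mat_factor[OF c(1,2) Hc c(3)] by blast
  then have "det (quad_span_mat \<Delta> r s ?S) * det (alpha \<Delta> r s H) = det Q * det (quad_span_mat \<Delta> r s ?T)"
    by (metis det_mult quad_span_mat_carrier c(1,2) alpha_carrier Hc)
  moreover have "det (alpha \<Delta> r s H) \<noteq> 0"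
  proof -
    have "padic_residue (det (alpha \<Delta> r s G)) dvd padic_residue 1"
      by (rule padic_residue.hom_dvd[OF det_alpha_unit[OF G]])
    then show ?thesis
      unfolding H_def padic_residue.hom_alpha[OF Gc, symmetric] padic_residue.hom_det by auto
  qed
  ultimately show ?thesis using det by auto
qed

theorem theorem3p3p3:
  fixes \<Delta> r s :: nat and R :: "int set" and \<sigma>\<^sub>1 \<sigma>\<^sub>2 :: "int mat"
  assumes "odd CARD('p::prime_card)"
    and "\<Delta> > 0" and "squarefree \<Delta>"
    and "inert_in_imag_quad_field CARD('p) \<Delta>"
    and "complete_residue_system CARD('p) R"
    and "\<sigma>\<^sub>1 \<in> S_open CARD('p) R (r + s)"
    and "\<sigma>\<^sub>2 \<in> S_open CARD('p) R (r + s)"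
    and "\<sigma>\<^sub>1 \<in> D_set TYPE('p) \<Delta> r s R (2 * (r + s))"
    and "\<sigma>\<^sub>2 \<notin> D_set TYPE('p) \<Delta> r s R (2 * (r + s))"
  shows "\<not> D_equivalent TYPE('p) \<Delta> r s \<sigma>\<^sub>1 \<sigma>\<^sub>2"
proof
  assume equivalent: "D_equivalent TYPE('p) \<Delta> r s \<sigma>\<^sub>1 \<sigma>\<^sub>2"
  obtain S where S: "S \<in> carrier_mat (r + s) (r + s)" "\<sigma>\<^sub>1 = sigma_mat CARD('p) S"
    and "det (quad_span_mat \<Delta> r s (map_mat of_int S :: 'p mod_ring mat)) \<noteq> 0"
    using assms(8) subspace_dim_quad_span_iff[where 'p = 'p]
    unfolding D_set_def sym_residue_mats_def by blast
  moreover obtain T where T: "T \<in> carrier_mat (r + s) (r + s)" "\<sigma>\<^sub>2 = sigma_mat CARD('p) T"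
    and "det (quad_span_mat \<Delta> r s (map_mat of_int T :: 'p mod_ring mat)) = 0"
    using assms(7,9) subspace_dim_quad_span_iff[where 'p = 'p, of _ r s \<Delta>]
    unfolding D_set_def S_open_def sym_residue_mats_def by blast
  ultimately show False
    using D_equivalent_imp_det[OF equivalent[unfolded S(2) T(2)]] by blast
qed

end
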